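(* Let $M$ be a Symmetric Perfect Matroid Design (SPMD) of rank $r$ on ground set $E$, and let $B$ be a basis of $M$. Then the number of elements $e$ such that $B\cup\{e\}$ is a circuit of $M$ is precisely \[ n=\sum_{k=0}^{r}(-1)^{r-k}\binom{r}{k}\bigl(\langle k\rangle-k\bigr). \]
   Context: A matroid $M$ of rank $r$ is called a Symmetric Perfect Matroid Design (SPMD) if (i) for each $j<r$, all flats of rank $j$ in $M$ are isomorphic (as matroids, under restriction), and (ii) for all $s,u$, the number of flats of rank $s$ in $M$ containing a fixed flat of rank $u$ does not depend on the choice of that flat. For $0\le k\le r$, $\langle k\rangle$ denotes the number of flats of rank $1$ in an SPMD of rank $k$ arising from $M$: for $k<r$ the number of rank-$1$ flats contained in a (any) rank-$k$ flat of $M$, and for $k=r$ the number of rank-$1$ flats of $M$. In particular $\langle 0\rangle=0$ and $\langle 1\rangle=1$.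
   Formalization: M is assumed finite and simple (no loops or parallel elements), so that elements correspond to rank-1 flats; without this the formula fails, e.g. for two parallel elements in rank 1 the count is 1 but the sum is 0. *)

theory Defs
  imports Complex_Main
begin

locale matroid =
  fixes E :: "'a set" and indep :: "'a set \<Rightarrow> bool"
  assumes finite_ground: "finite E"
    and indep_subset_ground: "indep X \<Longrightarrow> X \<subseteq> E"
    and indep_empty: "indep {}"
    and indep_subset: "indep X \<Longrightarrow> Y \<subseteq> X \<Longrightarrow> indep Y"
    and indep_augment: "indep X \<Longrightarrow> indep Y \<Longrightarrow> card X < card Y \<Longrightarrow> \<exists>y\<in>Y - X. indep (insert y X)"

definition matroid_basis :: "('a set \<Rightarrow> bool) \<Rightarrow> 'a set \<Rightarrow> bool" where
  "matroid_basis indep B \<longleftrightarrow> indep B \<and> (\<forall>X. indep X \<and> B \<subseteq> X \<longrightarrow> X = B)"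

definition matroid_circuit :: "'a set \<Rightarrow> ('a set \<Rightarrow> bool) \<Rightarrow> 'a set \<Rightarrow> bool" where
  "matroid_circuit E indep C \<longleftrightarrow> C \<subseteq> E \<and> \<not> indep C \<and> (\<forall>X. X \<subset> C \<longrightarrow> indep X)"

definition matroid_rank :: "('a set \<Rightarrow> bool) \<Rightarrow> 'a set \<Rightarrow> nat" where
  "matroid_rank indep X = Max {card I |I. I \<subseteq> X \<and> indep I}"

definition matroid_flat :: "'a set \<Rightarrow> ('a set \<Rightarrow> bool) \<Rightarrow> 'a set \<Rightarrow> bool" where
  "matroid_flat E indep F \<longleftrightarrow>
     F \<subseteq> E \<and> (\<forall>e\<in>E - F. matroid_rank indep F < matroid_rank indep (insert e F))"

definition flats_of_rank :: "'a set \<Rightarrow> ('a set \<Rightarrow> bool) \<Rightarrow> nat \<Rightarrow> 'a set set" where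
  "flats_of_rank E indep k = {F. matroid_flat E indep F \<and> matroid_rank indep F = k}"

definition matroid_restrict :: "('a set \<Rightarrow> bool) \<Rightarrow> 'a set \<Rightarrow> 'a set \<Rightarrow> bool" where
  "matroid_restrict indep F = (\<lambda>X. X \<subseteq> F \<and> indep X)"

definition matroid_isomorphic ::
    "'a set \<Rightarrow> ('a set \<Rightarrow> bool) \<Rightarrow> 'b set \<Rightarrow> ('b set \<Rightarrow> bool) \<Rightarrow> bool" where
  "matroid_isomorphic E indep E' indep' \<longleftrightarrow>
     (\<exists>f. bij_betw f E E' \<and> (\<forall>X\<subseteq>E. indep X \<longleftrightarrow> indep' (f ` X)))"

text \<open>No loops and no parallel elements.\<close>

definition matroid_simple :: "'a set \<Rightarrow> ('a set \<Rightarrow> bool) \<Rightarrow> bool" where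
  "matroid_simple E indep \<longleftrightarrow> (\<forall>C. matroid_circuit E indep C \<longrightarrow> card C \<ge> 3)"

locale spmd = matroid +
  assumes flats_isomorphic:
    "j < matroid_rank indep E \<Longrightarrow> F \<in> flats_of_rank E indep j \<Longrightarrow> G \<in> flats_of_rank E indep j \<Longrightarrow>
       matroid_isomorphic F (matroid_restrict indep F) G (matroid_restrict indep G)"
    and card_flats_containing:
    "F \<in> flats_of_rank E indep u \<Longrightarrow> G \<in> flats_of_rank E indep u \<Longrightarrow>
       card {H \<in> flats_of_rank E indep s. F \<subseteq> H} = card {H \<in> flats_of_rank E indep s. G \<subseteq> H}"

text \<open>
  The number \<open>\<langle>k\<rangle>\<close>. The choice of the flat of rank \<open>k\<close> is immaterial
  in an SPMD. Only \<open>k \<le> r\<close> is meaningful, where \<open>r\<close> is the rank of the matroid.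
\<close>

definition spmd_number :: "'a set \<Rightarrow> ('a set \<Rightarrow> bool) \<Rightarrow> nat \<Rightarrow> nat" where
  "spmd_number E indep k =
     (if k < matroid_rank indep E
      then card {P \<in> flats_of_rank E indep 1. P \<subseteq> (SOME F. F \<in> flats_of_rank E indep k)}
      else card (flats_of_rank E indep 1))"

end

theory Submission
  imports Defs
begin

text \<open>
  For \<open>e \<in> E - B\<close> let \<open>C e\<close> be the set of \<open>b \<in> B\<close> that can be exchanged for \<open>e\<close>, so that
  \<open>insert e (C e)\<close> is the fundamental circuit of \<open>e\<close>. For \<open>S \<subseteq> B\<close> the flat spanned by \<open>S\<close>
  consists of \<open>S\<close> and of those \<open>e\<close> with \<open>C e \<subseteq> S\<close>. As \<open>M\<close> is simple, this flat has
  \<open>\<langle>card S\<rangle>\<close> elements, so \<open>\<langle>card S\<rangle> - card S\<close> counts the \<open>e\<close> with \<open>C e \<subseteq> S\<close>, and Moebius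
  inversion over the subsets of \<open>B\<close> counts the \<open>e\<close> with \<open>C e = B\<close>.
\<close>

section \<open>Summation over subsets by size\<close>

lemma sum_Pow_card:
  fixes f :: "nat \<Rightarrow> 'b::comm_semiring_1"
  assumes "finite B"
  shows "(\<Sum>S\<in>Pow B. f (card S)) = (\<Sum>k=0..card B. of_nat (card B choose k) * f k)"
proof -
  have "(\<Sum>S\<in>Pow B. f (card S)) = (\<Sum>k=0..card B. \<Sum>S\<in>{S \<in> Pow B. card S = k}. f (card S))"
    using assms by (intro sum.group [symmetric]) (auto intro: card_mono)
  also have "\<dots> = (\<Sum>k=0..card B. of_nat (card B choose k) * f k)"
    using assms by (intro sum.cong) (auto simp: n_subsets)
  finally show ?thesis .
qed

section \<open>Rank and spanned flats\<close>

context matroid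
begin

lemma finite_indep: "indep X \<Longrightarrow> finite X"
  using finite_ground finite_subset indep_subset_ground by blast

lemma finite_cards: "finite {card I |I. I \<subseteq> X \<and> indep I}"
proof (rule finite_subset)
  show "{card I |I. I \<subseteq> X \<and> indep I} \<subseteq> {..card E}"
    using card_mono finite_ground indep_subset_ground by fastforce
qed simp

lemma rank_ge: "indep I \<Longrightarrow> I \<subseteq> X \<Longrightarrow> card I \<le> matroid_rank indep X"
  unfolding matroid_rank_def by (intro Max_ge finite_cards) auto

text \<open>By augmentation, an independent subset of \<open>X\<close> larger than \<open>I\<close>
  would supply an element of \<open>X - I\<close> that can be added to \<open>I\<close>.\<close>

lemma rank_eqI:
  assumes "indep I" "I \<subseteq> X" "\<And>x. x \<in> X - I \<Longrightarrow> \<not> indep (insert x I)"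
  shows "matroid_rank indep X = card I"
  unfolding matroid_rank_def
proof (intro Max_eqI finite_cards)
  fix n assume "n \<in> {card J |J. J \<subseteq> X \<and> indep J}"
  then obtain J where J: "J \<subseteq> X" "indep J" "n = card J" by auto
  show "n \<le> card I"
  proof (rule ccontr)
    assume "\<not> n \<le> card I"
    then obtain y where "y \<in> J - I" "indep (insert y I)"
      using indep_augment [OF assms(1) J(2)] J(3) by auto
    then show False using assms(3) J(1) by blast
  qed
qed (use assms in auto)

text \<open>The closure operator, in a form that is right for independent \<open>S\<close> only: if
  \<open>S\<close> is dependent, every element of \<open>E\<close> meets the condition.\<close>

definition span :: "'a set \<Rightarrow> 'a set" where
  "span S = S \<union> {e \<in> E. \<not> indep (insert e S)}"

text \<open>\<open>S\<close> is a maximal independent subset of \<open>span S\<close>, and each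
  element of \<open>E\<close> outside \<open>span S\<close> extends \<open>S\<close> to a larger
  independent set.\<close>

lemma span_in_flats:
  assumes "indep S"
  shows "span S \<in> flats_of_rank E indep (card S)"
proof -
  have rank: "matroid_rank indep (span S) = card S"
    using assms by (intro rank_eqI) (auto simp: span_def)
  have "card S < matroid_rank indep (insert e (span S))" if "e \<in> E - span S" for e
  proof -
    have e: "indep (insert e S)" "e \<notin> S" using that by (auto simp: span_def)
    have "insert e S \<subseteq> insert e (span S)" by (auto simp: span_def)
    from rank_ge [OF e(1) this] show ?thesis using e(2) finite_indep [OF assms] by simp
  qed
  then show ?thesis
    using rank indep_subset_ground [OF assms]
    by (auto simp: flats_of_rank_def matroid_flat_def span_def)
qed

section \<open>Circuits and points of a simple matroid\<close>

lemma dependent_contains_circuit: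
  assumes "X \<subseteq> E" "\<not> indep X"
  obtains C where "C \<subseteq> X" "matroid_circuit E indep C"
proof -
  have fin: "finite X" using assms(1) finite_ground finite_subset by blast
  have "finite {C. C \<subseteq> X \<and> \<not> indep C}" "X \<in> {C. C \<subseteq> X \<and> \<not> indep C}"
    using fin assms by auto
  from finite_has_minimal2 [OF this]
  obtain C where C: "C \<subseteq> X" "\<not> indep C"
    and minimal: "\<forall>D\<in>{C. C \<subseteq> X \<and> \<not> indep C}. D \<le> C \<longrightarrow> C = D"
    by (elim bexE conjE CollectE) rule
  have "indep D" if "D \<subset> C" for D
    using bspec [OF minimal, of D] that C(1) by auto
  with C assms(1) have "matroid_circuit E indep C"
    by (auto simp: matroid_circuit_def)
  with C(1) that show thesis by simp
qed

text \<open>A circuit inside \<open>{e, f}\<close> would have at most two elements. The case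
  \<open>e = f\<close> is included and excludes loops.\<close>

lemma simple_indep_pair:
  assumes "matroid_simple E indep" "e \<in> E" "f \<in> E"
  shows "indep {e, f}"
proof (rule ccontr)
  assume "\<not> indep {e, f}"
  then obtain C where C: "C \<subseteq> {e, f}" "matroid_circuit E indep C"
    using dependent_contains_circuit [of "{e, f}"] assms by blast
  have "card C \<le> card {e, f}" using C(1) by (intro card_mono) auto
  also have "\<dots> \<le> 2" by (simp add: card_insert_if)
  finally show False using C(2) assms(1) by (auto simp: matroid_simple_def)
qed

lemma simple_flats_of_rank_1:
  assumes "matroid_simple E indep"
  shows "flats_of_rank E indep 1 = (\<lambda>e. {e}) ` E"
proof (intro equalityI subsetI)
  fix P assume "P \<in> flats_of_rank E indep 1"
  then have P: "P \<subseteq> E" "matroid_rank indep P = 1"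
    by (auto simp: flats_of_rank_def matroid_flat_def)
  have "P \<noteq> {}"
    using P(2) rank_eqI [OF indep_empty, of P] by auto
  then obtain e where e: "e \<in> P" by blast
  have "f = e" if "f \<in> P" for f
  proof (rule ccontr)
    assume "f \<noteq> e"
    moreover have "card {e, f} \<le> matroid_rank indep P"
      using e that P(1) by (intro rank_ge simple_indep_pair [OF assms]) auto
    ultimately show False using P(2) by simp
  qed
  with e P(1) show "P \<in> (\<lambda>e. {e}) ` E" by blast
next
  fix P assume "P \<in> (\<lambda>e. {e}) ` E"
  then obtain e where e: "e \<in> E" "P = {e}" by blast
  have "span {e} = {e}"
    using simple_indep_pair [OF assms] e by (auto simp: span_def)
  then show "P \<in> flats_of_rank E indep 1"
    using span_in_flats [of "{e}"] simple_indep_pair [OF assms e(1) e(1)] e by simp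
qed

text \<open>Turns the count of rank-1 flats in \<open>spmd_number\<close> into a count of
  elements.\<close>

lemma simple_card_points:
  assumes "matroid_simple E indep" "F \<subseteq> E"
  shows "card {P \<in> flats_of_rank E indep 1. P \<subseteq> F} = card F"
proof -
  have "{P \<in> flats_of_rank E indep 1. P \<subseteq> F} = (\<lambda>e. {e}) ` F"
    unfolding simple_flats_of_rank_1 [OF assms(1)] using assms(2) by auto
  then show ?thesis by (simp add: card_image)
qed

section \<open>Bases and exchange\<close>

lemma basis_indep: "matroid_basis indep B \<Longrightarrow> indep B"
  by (simp add: matroid_basis_def)

lemma basis_maximal: "matroid_basis indep B \<Longrightarrow> e \<notin> B \<Longrightarrow> \<not> indep (insert e B)"
  unfolding matroid_basis_def by blast

lemma basis_card: "matroid_basis indep B \<Longrightarrow> card B = matroid_rank indep E"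
  using basis_maximal basis_indep indep_subset_ground by (intro rank_eqI [symmetric]) auto

lemma basis_span: "matroid_basis indep B \<Longrightarrow> span B = E"
  using basis_maximal indep_subset_ground [OF basis_indep, of B] by (auto simp: span_def)

text \<open>Repeated augmentation of \<open>I\<close> from \<open>J\<close>. With a basis as
  \<open>J\<close>, it completes \<open>I\<close> to the size of a basis using only elements of that
  basis.\<close>

lemma indep_extend:
  assumes "indep I" "indep J" "card I \<le> card J"
  shows "\<exists>K. I \<subseteq> K \<and> K \<subseteq> I \<union> J \<and> indep K \<and> card K = card J"
  using assms(1,3)
proof (induction "card J - card I" arbitrary: I)
  case 0
  then have "card I = card J" by simp
  with 0 show ?case by blast
next
  case (Suc n)
  have "card I < card J" using Suc.hyps(2) by simp
  from indep_augment [OF Suc.prems(1) assms(2) this]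
  obtain y where y: "y \<in> J - I" "indep (insert y I)" by blast
  have card: "card (insert y I) = Suc (card I)"
    using y finite_indep [OF Suc.prems(1)] by simp
  have "n = card J - card (insert y I)" "card (insert y I) \<le> card J"
    using card Suc.hyps(2) by simp_all
  from Suc.hyps(1) [OF this(1) y(2) this(2)] show ?case
    using y(1) by blast
qed

text \<open>This is \<open>C e\<close> of the overview. For \<open>e\<close> in an independent
  \<open>B\<close> it is all of \<open>B\<close>, so \<open>e \<notin> B\<close> has to be required
  separately.\<close>

definition exchangeable :: "'a set \<Rightarrow> 'a \<Rightarrow> 'a set" where
  "exchangeable B e = {b \<in> B. indep (insert e (B - {b}))}"

text \<open>If \<open>insert e S\<close> is independent, completing it from \<open>B\<close> to the
  size of \<open>B\<close> omits exactly one \<open>b\<close> of \<open>B\<close>, which is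
  exchangeable and outside \<open>S\<close>. Conversely, an exchangeable \<open>b\<close> outside
  \<open>S\<close> puts \<open>insert e S\<close> inside the independent set
  \<open>insert e (B - {b})\<close>.\<close>

lemma exchangeable_subset_iff:
  assumes B: "matroid_basis indep B" and S: "S \<subseteq> B" and e: "e \<in> E - B"
  shows "exchangeable B e \<subseteq> S \<longleftrightarrow> e \<in> span S"
proof
  assume sub: "exchangeable B e \<subseteq> S"
  show "e \<in> span S"
  proof (rule ccontr)
    assume "e \<notin> span S"
    then have ind: "indep (insert e S)" using e by (auto simp: span_def)
    have finB: "finite B" using basis_indep [OF B] finite_indep by blast
    \<comment> \<open>Strict inclusion leaves room for \<open>e\<close>, as the size condition of
      \<open>indep_extend\<close> demands.\<close>
    have "S \<noteq> B" using ind basis_maximal [OF B] e by blast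
    then have "card S < card B" using S finB by (simp add: psubsetI psubset_card_mono)
    then have "card (insert e S) \<le> card B"
      using finite_subset [OF S finB] by (auto simp: card_insert_if)
    then obtain K where K: "insert e S \<subseteq> K" "K \<subseteq> insert e S \<union> B" "indep K" "card K = card B"
      using indep_extend [OF ind basis_indep [OF B]] by blast
    have finK: "finite K" using K(3) finite_indep by blast
    \<comment> \<open>Comparing sizes shows that \<open>K\<close> arises from \<open>B\<close> by
      exchanging a single \<open>b\<close> for \<open>e\<close>.\<close>
    have "card (K - {e}) < card B"
      using K(1,4) finK by (metis card_Diff1_less insert_subset)
    moreover have KB: "K - {e} \<subseteq> B" using K(2) S by blast
    ultimately have "K - {e} \<subset> B" by auto
    then obtain b where b: "b \<in> B" "b \<notin> K - {e}" by blast
    have "K - {e} \<subseteq> B - {b}" using KB b by blast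
    moreover have "card (K - {e}) = card (B - {b})"
      using K(1,4) finK finB b(1) by (simp add: card_Diff_singleton)
    ultimately have "K - {e} = B - {b}"
      using finB by (intro card_subset_eq) auto
    then have "insert e (B - {b}) = K" using K(1) by blast
    then have "b \<in> exchangeable B e" using K(3) b(1) by (simp add: exchangeable_def)
    then have "b \<in> S" using sub by blast
    then show False using K(1) b e by blast
  qed
next
  assume "e \<in> span S"
  then have dep: "\<not> indep (insert e S)" using e S by (auto simp: span_def)
  show "exchangeable B e \<subseteq> S"
  proof
    fix b assume b: "b \<in> exchangeable B e"
    show "b \<in> S"
    proof (rule ccontr)
      assume "b \<notin> S"
      then have "insert e S \<subseteq> insert e (B - {b})" using S by blast
      with b dep indep_subset show False by (auto simp: exchangeable_def)
    qed
  qed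
qed

text \<open>For \<open>e\<close> outside \<open>B\<close>, only minimality is in question, and it
  suffices to delete one element: deleting \<open>e\<close> leaves \<open>B\<close>, deleting
  \<open>b\<close> leaves the set that defines exchangeability.\<close>

lemma circuit_iff_exchangeable:
  assumes B: "matroid_basis indep B" and e: "e \<in> E"
  shows "matroid_circuit E indep (B \<union> {e}) \<longleftrightarrow> e \<notin> B \<and> exchangeable B e = B"
proof (cases "e \<in> B")
  case True
  then show ?thesis
    using basis_indep [OF B] by (auto simp: matroid_circuit_def insert_absorb)
next
  case False
  have dep: "\<not> indep (insert e B)" using basis_maximal [OF B False] .
  have sub: "insert e B \<subseteq> E" using e basis_indep [OF B] indep_subset_ground by blast
  have "(\<forall>X. X \<subset> insert e B \<longrightarrow> indep X) \<longleftrightarrow> exchangeable B e = B"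
  proof
    assume *: "\<forall>X. X \<subset> insert e B \<longrightarrow> indep X"
    have "indep (insert e (B - {b}))" if "b \<in> B" for b
    proof -
      have "insert e (B - {b}) \<subset> insert e B" using that False by auto
      with * show ?thesis by simp
    qed
    then show "exchangeable B e = B" by (auto simp: exchangeable_def)
  next
    assume *: "exchangeable B e = B"
    show "\<forall>X. X \<subset> insert e B \<longrightarrow> indep X"
    proof (intro allI impI)
      fix X assume X: "X \<subset> insert e B"
      then obtain x where x: "x \<in> insert e B" "x \<notin> X" by blast
      show "indep X"
      proof (cases "x = e")
        case True
        then show ?thesis using X x indep_subset [OF basis_indep [OF B]] by blast
      next
        case False
        then have "indep (insert e (B - {x}))" using * x by (auto simp: exchangeable_def)
        moreover have "X \<subseteq> insert e (B - {x})" using X x by blast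
        ultimately show ?thesis using indep_subset by blast
      qed
    qed
  qed
  then show ?thesis using False dep sub by (simp add: matroid_circuit_def)
qed

end

section \<open>Design numbers and Moebius inversion\<close>

text \<open>Below full rank, isomorphic flats of equal rank have equally many elements, so the
  chosen flat may be replaced by \<open>span S\<close>. At full rank, \<open>S = B\<close> spans
  \<open>E\<close>.\<close>

lemma (in spmd) spmd_number_eq_card_span:
  assumes simple: "matroid_simple E indep" and B: "matroid_basis indep B" and S: "S \<subseteq> B"
  shows "spmd_number E indep (card S) = card (span S)"
proof -
  have finB: "finite B" using basis_indep [OF B] finite_indep by blast
  show ?thesis
  proof (cases "S = B")
    case True
    have "card (flats_of_rank E indep 1) = card E"
      unfolding simple_flats_of_rank_1 [OF simple] by (simp add: card_image)
    with True show ?thesis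
      by (simp add: spmd_number_def basis_card [OF B] basis_span [OF B])
  next
    case False
    then have less: "card S < matroid_rank indep E"
      using S finB basis_card [OF B] psubset_card_mono [of B S] by auto
    let ?F = "SOME F. F \<in> flats_of_rank E indep (card S)"
    have span: "span S \<in> flats_of_rank E indep (card S)"
      using span_in_flats indep_subset [OF basis_indep [OF B] S] by blast
    \<comment> \<open>\<open>span S\<close> witnesses that the choice is made from a nonempty
      set.\<close>
    then have F: "?F \<in> flats_of_rank E indep (card S)" by (rule someI)
    have "card ?F = card (span S)"
      using flats_isomorphic [OF less F span]
      by (auto simp: matroid_isomorphic_def dest: bij_betw_same_card)
    moreover have "?F \<subseteq> E" using F by (simp add: flats_of_rank_def matroid_flat_def)
    ultimately show ?thesis
      using less by (simp add: spmd_number_def simple_card_points [OF simple] del: One_nat_def)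
  qed
qed

theorem theorem2:
  fixes E :: "'a set" and indep :: "'a set \<Rightarrow> bool" and B :: "'a set" and r :: nat
  assumes "spmd E indep"
    and "matroid_simple E indep"
    and "matroid_rank indep E = r"
    and "matroid_basis indep B"
  shows "int (card {e \<in> E. matroid_circuit E indep (B \<union> {e})}) =
    (\<Sum>k=0..r. (-1) ^ (r - k) * int (r choose k) * (int (spmd_number E indep k) - int k))"
proof -
  interpret spmd E indep by fact
  note simple = assms(2) and B = assms(4)
  have finB: "finite B" using basis_indep [OF B] finite_indep by blast
  have r: "card B = r" using basis_card [OF B] assms(3) by simp
  let ?C = "exchangeable B"
  \<comment> \<open>\<open>g B\<close> is the number sought; \<open>f\<close> is its cumulative
    version, which the design numbers determine.\<close>
  define f where "f S = int (card {e \<in> E - B. ?C e \<subseteq> S})" for S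
  define g where "g S = int (card {e \<in> E - B. ?C e = S})" for S
  have f_sum: "f S = sum g (Pow S)" if "finite S" for S
  proof -
    have "card {e \<in> E - B. ?C e \<subseteq> S} = card (\<Union>T\<in>Pow S. {e \<in> E - B. ?C e = T})"
      by (rule arg_cong [where f = card]) auto
    also have "\<dots> = (\<Sum>T\<in>Pow S. card {e \<in> E - B. ?C e = T})"
      using that finite_ground by (intro card_UN_disjoint) auto
    finally show ?thesis by (simp add: f_def g_def)
  qed
  have f_eq: "f S = int (spmd_number E indep (card S)) - int (card S)" if S: "S \<subseteq> B" for S
  proof -
    have indS: "indep S" using indep_subset [OF basis_indep [OF B] S] .
    \<comment> \<open>\<open>insert b S\<close> lies in \<open>B\<close> and is thus independent, so
      all that \<open>span S\<close> adds to \<open>S\<close> lies outside \<open>B\<close>.\<close>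
    have "b \<notin> span S" if "b \<in> B - S" for b
      using that S indep_subset [OF basis_indep [OF B], of "insert b S"] by (auto simp: span_def)
    moreover have "span S \<subseteq> E" using indep_subset_ground [OF indS] by (auto simp: span_def)
    ultimately have "span S = S \<union> {e \<in> E - B. ?C e \<subseteq> S}"
      using exchangeable_subset_iff [OF B S] by (auto simp: span_def)
    moreover have "card (S \<union> {e \<in> E - B. ?C e \<subseteq> S}) = card S + card {e \<in> E - B. ?C e \<subseteq> S}"
      using S finite_indep [OF indS] finite_ground by (intro card_Un_disjoint) auto
    ultimately show ?thesis
      by (simp add: f_def spmd_number_eq_card_span [OF simple B S])
  qed
  have "int (card {e \<in> E. matroid_circuit E indep (B \<union> {e})}) = g B"
    unfolding g_def using circuit_iff_exchangeable [OF B]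
    by (intro arg_cong [where f = "\<lambda>A. int (card A)"]) auto
  \<comment> \<open>Moebius inversion on the subset lattice of \<open>B\<close>.\<close>
  also have "\<dots> = (\<Sum>S\<in>Pow B. (-1) ^ (card B - card S) * f S)"
    using f_sum finB by (rule inclusion_exclusion_mobius)
  also have "\<dots> = (\<Sum>S\<in>Pow B. (-1) ^ (r - card S) *
      (int (spmd_number E indep (card S)) - int (card S)))"
    by (intro sum.cong) (auto simp: f_eq r)
  also have "\<dots> = (\<Sum>k=0..r. (-1) ^ (r - k) * int (r choose k) *
      (int (spmd_number E indep k) - int k))"
    by (subst sum_Pow_card [OF finB, where
          f = "\<lambda>k. (-1) ^ (r - k) * (int (spmd_number E indep k) - int k)"])
      (simp add: r mult_ac)
  finally show ?thesis .
qed

end
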